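(* For each integer $n\ge1$ let $v_0,v_1,\dots,v_n$ (possibly depending on $n$) be independent and identically distributed square-integrable real random variables whose common distribution does not depend on $n$. Put $\Delta v_k=v_k-v_{k-1}$ for $k=1,\dots,n$ and $$r^n_{k,l}=\sqrt{\frac{2}{n+1}}\,\sin\left(\frac{kl\pi}{n+1}\right),\qquad k,l=1,\dots,n.$$ Let $(m_n)_{n\ge1}$ be a sequence of integers with $1\le m_n\le n$ and $m_n=o(n^{1/2})$ as $n\to\infty$. Then $$\lim_{n\to\infty}\mathbf{E}\left[\frac{n+1}{m_n}\sum_{l=1}^{m_n}\left(\sum_{k=1}^{n} r^n_{k,l}\,\Delta v_k\right)^2\right]=0.$$
   Context: The random variables $v_k$ model the additive micro-structure noise in the observations $Y_k=X_k+v_k$, $k=0,1,\dots,n$, of an Itô process $X$, including noise $v_0$ in the initial observation. $\mathbf{E}$ denotes expectation. *)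

theory Defs
  imports "HOL-Probability.Probability" "HOL-Library.Landau_Symbols"
begin

(* Only used for 1 <= k, l <= n. *)
definition r_coeff :: "nat \<Rightarrow> nat \<Rightarrow> nat \<Rightarrow> real" where
  "r_coeff n k l =
     sqrt (2 / real (n + 1)) * sin (real k * real l * pi / real (n + 1))"

(* Only used for 1 <= k, so the subtraction k - 1 on nat does not truncate. *)
definition incr :: "(nat \<Rightarrow> 'a \<Rightarrow> real) \<Rightarrow> nat \<Rightarrow> 'a \<Rightarrow> real" where
  "incr v k \<omega> = v k \<omega> - v (k - 1) \<omega>"

end

theory Submission imports Defs begin

text \<open>
  The sine weights vanish at \<open>k = 0\<close> and \<open>k = n + 1\<close>, so summation by parts turns
  \<open>\<Sum>k=1..n. r\<^sub>k * (v\<^sub>k - v\<^sub>k\<^sub>-\<^sub>1)\<close> into \<open>\<Sum>k\<le>n. d\<^sub>k * v\<^sub>k\<close> with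
  \<open>d\<^sub>k = r\<^sub>k - r\<^sub>k\<^sub>+\<^sub>1\<close>, without boundary terms (lemma \<open>sum_by_parts_zero_ends\<close>).
  The same vanishing makes the \<open>d\<^sub>k\<close> sum to zero, so the mean of the noise drops out and, by
  independence, the expected square is the variance of the noise times \<open>\<Sum>k\<le>n. d\<^sub>k\<^sup>2\<close>
  (lemma \<open>expectation_square_weighted_iid_sum\<close>).  The \<open>l\<close>-th weight is a slowly oscillating
  sine: consecutive values differ by at most \<open>sqrt (2 / (n+1)) * l * pi / (n+1)\<close>, so the sum of
  the \<open>n + 1\<close> squares is at most \<open>2 * (l * pi / (n+1))\<^sup>2\<close>.  Averaging over \<open>l \<le> m\<^sub>n\<close>, where
  \<open>l\<^sup>2 \<le> m\<^sub>n\<^sup>2\<close>, and multiplying by \<open>n + 1\<close> leaves a quantity of order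
  \<open>m\<^sub>n\<^sup>2 / n = (m\<^sub>n / n\<^bsup>1/2\<^esup>)\<^sup>2\<close>, which tends to zero.
\<close>

lemma sum_by_parts_zero_ends:
  fixes a x :: "nat \<Rightarrow> 'a :: comm_ring"
  assumes "a 0 = 0" "a (Suc n) = 0"
  shows "(\<Sum>k=1..n. a k * (x k - x (k - 1))) = (\<Sum>k\<le>n. (a k - a (Suc k)) * x k)"
proof -
  \<comment> \<open>With the upper boundary term kept, the identity can be proved by induction.\<close>
  have "(\<Sum>k=1..N. a k * (x k - x (k - 1))) =
        (\<Sum>k\<le>N. (a k - a (Suc k)) * x k) + a (Suc N) * x N" for N
    by (induction N) (simp_all add: assms(1) algebra_simps)
  then show ?thesis
    using assms(2) by simp
qed

text \<open>
  Expanding the square, the expectation of \<open>X i * X j\<close> is \<open>\<mu>\<^sup>2\<close> off the diagonal, by pairwise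
  independence, and exceeds \<open>\<mu>\<^sup>2\<close> by the variance \<open>s - \<mu>\<^sup>2\<close> on it.
\<close>

lemma (in prob_space) expectation_square_weighted_iid_sum:
  fixes X :: "'i \<Rightarrow> 'a \<Rightarrow> real" and c :: "'i \<Rightarrow> real"
  assumes fin: "finite I"
    and indep: "indep_vars (\<lambda>_. borel) X I"
    and sq: "\<And>i. i \<in> I \<Longrightarrow> integrable M (\<lambda>\<omega>. (X i \<omega>)\<^sup>2)"
    and mean: "\<And>i. i \<in> I \<Longrightarrow> expectation (X i) = \<mu>"
    and second: "\<And>i. i \<in> I \<Longrightarrow> expectation (\<lambda>\<omega>. (X i \<omega>)\<^sup>2) = s"
  shows "integrable M (\<lambda>\<omega>. (\<Sum>i\<in>I. c i * X i \<omega>)\<^sup>2)" (is ?integrable)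
    and "expectation (\<lambda>\<omega>. (\<Sum>i\<in>I. c i * X i \<omega>)\<^sup>2) =
           (s - \<mu>\<^sup>2) * (\<Sum>i\<in>I. (c i)\<^sup>2) + \<mu>\<^sup>2 * (\<Sum>i\<in>I. c i)\<^sup>2" (is ?expectation)
proof -
  have int: "integrable M (X i)" if "i \<in> I" for i
  proof (rule square_integrable_imp_integrable[OF _ sq[OF that]])
    show "X i \<in> borel_measurable M"
      using indep that unfolding indep_vars_def2 by blast
  qed
  have prod: "integrable M (\<lambda>\<omega>. X i \<omega> * X j \<omega>) \<and>
              expectation (\<lambda>\<omega>. X i \<omega> * X j \<omega>) = \<mu>\<^sup>2 + (if i = j then s - \<mu>\<^sup>2 else 0)"
    if ij: "i \<in> I" "j \<in> I" for i j
  proof (cases "i = j")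
    case True
    then show ?thesis using sq second ij by (simp flip: power2_eq_square)
  next
    case False
    have "indep_vars (\<lambda>_. borel) X {i, j}"
      using indep_vars_subset[OF indep] ij by simp
    from indep_vars_lebesgue_integral[OF _ this] indep_vars_integrable[OF _ this]
    show ?thesis using False int mean ij by (auto simp: power2_eq_square)
  qed
  have square: "(\<Sum>i\<in>I. c i * X i \<omega>)\<^sup>2 = (\<Sum>i\<in>I. \<Sum>j\<in>I. c i * c j * (X i \<omega> * X j \<omega>))" for \<omega>
    by (simp add: power2_eq_square sum_product mult_ac)
  show ?integrable
    unfolding square using prod by (intro Bochner_Integration.integrable_sum) auto
  have "expectation (\<lambda>\<omega>. (\<Sum>i\<in>I. c i * X i \<omega>)\<^sup>2) =
        (\<Sum>i\<in>I. \<Sum>j\<in>I. c i * c j * (\<mu>\<^sup>2 + (if i = j then s - \<mu>\<^sup>2 else 0)))"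
    unfolding square using prod
    by (simp add: Bochner_Integration.integral_sum Bochner_Integration.integrable_sum)
  also have "\<dots> = (\<Sum>i\<in>I. \<Sum>j\<in>I. \<mu>\<^sup>2 * (c i * c j)) + (\<Sum>i\<in>I. (s - \<mu>\<^sup>2) * (c i)\<^sup>2)"
    unfolding sum.distrib[symmetric] using fin
    by (intro sum.cong refl)
       (simp add: distrib_left sum.distrib if_distrib[of "(*) _"] power2_eq_square mult_ac cong: if_cong)
  also have "\<dots> = (s - \<mu>\<^sup>2) * (\<Sum>i\<in>I. (c i)\<^sup>2) + \<mu>\<^sup>2 * (\<Sum>i\<in>I. c i)\<^sup>2"
  proof -
    have "(\<Sum>i\<in>I. \<Sum>j\<in>I. \<mu>\<^sup>2 * (c i * c j)) = \<mu>\<^sup>2 * (\<Sum>i\<in>I. c i)\<^sup>2"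
      unfolding power2_eq_square[of "sum c I"] sum_product by (simp add: sum_distrib_left)
    then show ?thesis by (simp add: sum_distrib_left)
  qed
  finally show ?expectation .
qed

lemma abs_sin_diff_le: "\<bar>sin x - sin y\<bar> \<le> \<bar>x - y\<bar>" for x y :: real
proof -
  have "\<bar>sin x - sin y\<bar> = 2 * \<bar>sin ((x - y) / 2)\<bar> * \<bar>cos ((x + y) / 2)\<bar>"
    by (simp add: sin_diff_sin abs_mult)
  also have "\<dots> \<le> 2 * \<bar>(x - y) / 2\<bar> * 1"
    by (intro mult_mono mult_left_mono abs_sin_x_le_abs_x) auto
  finally show ?thesis by simp
qed

lemma r_coeff_ends [simp]: "r_coeff n 0 l = 0" "r_coeff n (Suc n) l = 0"
proof -
  have "real (Suc n) * real l * pi / real (n + 1) = real l * pi"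
    by (simp add: field_simps)
  then show "r_coeff n (Suc n) l = 0"
    unfolding r_coeff_def by simp
qed (simp add: r_coeff_def)

text \<open>
  The bound is that of \<open>n + 1\<close> increments of a sine taken at arguments \<open>l * pi / (n + 1)\<close> apart,
  each squared and scaled by the normalisation \<open>2 / (n + 1)\<close>.
\<close>

lemma sum_r_coeff_diff_squares_le:
  "(\<Sum>k\<le>n. (r_coeff n k l - r_coeff n (Suc k) l)\<^sup>2) \<le> 2 * (real l * pi / real (n + 1))\<^sup>2"
proof -
  let ?\<theta> = "real l * pi / real (n + 1)"
  have "(r_coeff n k l - r_coeff n (Suc k) l)\<^sup>2 \<le> 2 / real (n + 1) * ?\<theta>\<^sup>2" for k
  proof -
    have "\<bar>sin (real k * real l * pi / real (n + 1)) - sin (real (Suc k) * real l * pi / real (n + 1))\<bar>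
          \<le> \<bar>real k * real l * pi / real (n + 1) - real (Suc k) * real l * pi / real (n + 1)\<bar>"
      by (rule abs_sin_diff_le)
    also have "real k * real l * pi / real (n + 1) - real (Suc k) * real l * pi / real (n + 1) = - ?\<theta>"
      unfolding diff_divide_distrib[symmetric] minus_divide_left by (simp add: algebra_simps)
    finally have "(sin (real k * real l * pi / real (n + 1)) -
        sin (real (Suc k) * real l * pi / real (n + 1)))\<^sup>2 \<le> ?\<theta>\<^sup>2"
      by (simp only: abs_minus_cancel abs_le_square_iff)
    then have "2 / real (n + 1) * (sin (real k * real l * pi / real (n + 1)) -
        sin (real (Suc k) * real l * pi / real (n + 1)))\<^sup>2 \<le> 2 / real (n + 1) * ?\<theta>\<^sup>2"
      by (intro mult_left_mono) auto
    moreover have "(sqrt (2 / real (n + 1)))\<^sup>2 = 2 / real (n + 1)"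
      by (rule real_sqrt_pow2) simp
    ultimately show ?thesis
      unfolding r_coeff_def right_diff_distrib[symmetric] power_mult_distrib by simp
  qed
  then have "(\<Sum>k\<le>n. (r_coeff n k l - r_coeff n (Suc k) l)\<^sup>2) \<le> real (card {..n}) * (2 / real (n + 1) * ?\<theta>\<^sup>2)"
    by (intro sum_bounded_above) auto
  also have "\<dots> = 2 * ?\<theta>\<^sup>2"
    by simp
  finally show ?thesis .
qed

theorem proposition4p2:
  fixes M :: "'a measure"
    and v :: "nat \<Rightarrow> nat \<Rightarrow> 'a \<Rightarrow> real"
    and D :: "real measure"
    and m :: "nat \<Rightarrow> nat"
  assumes "prob_space M"
    and indep: "\<And>n. n \<ge> 1 \<Longrightarrow> prob_space.indep_vars M (\<lambda>_. borel) (v n) {0..n}"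
    and ident: "\<And>n k. n \<ge> 1 \<Longrightarrow> k \<le> n \<Longrightarrow> distr M borel (v n k) = D"
    and sq_int: "\<And>n k. n \<ge> 1 \<Longrightarrow> k \<le> n \<Longrightarrow> integrable M (\<lambda>\<omega>. (v n k \<omega>)\<^sup>2)"
    and m_bounds: "\<And>n. n \<ge> 1 \<Longrightarrow> 1 \<le> m n \<and> m n \<le> n"
    and m_small: "(\<lambda>n. real (m n)) \<in> o(\<lambda>n. real n powr (1/2))"
  shows "(\<lambda>n. \<integral>\<omega>. real (n + 1) / real (m n) *
            (\<Sum>l=1..m n. (\<Sum>k=1..n. r_coeff n k l * incr (v n) k \<omega>)\<^sup>2) \<partial>M)
          \<longlonglongrightarrow> 0"
proof -
  interpret prob_space M by fact
  define \<mu> where "\<mu> = (\<integral>x. x \<partial>D)"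
  define s where "s = (\<integral>x. x\<^sup>2 \<partial>D)"
  define d where "d n l k = r_coeff n k l - r_coeff n (Suc k) l" for n l k
  have meas: "v n k \<in> borel_measurable M" if "n \<ge> 1" "k \<le> n" for n k
    using indep[OF that(1)] that(2) by (auto simp: indep_vars_def2)
  have mean: "expectation (v n k) = \<mu>" if "n \<ge> 1" "k \<le> n" for n k
    unfolding \<mu>_def ident[OF that, symmetric] by (subst integral_distr) (auto intro: meas that)
  have second: "expectation (\<lambda>\<omega>. (v n k \<omega>)\<^sup>2) = s" if "n \<ge> 1" "k \<le> n" for n k
    unfolding s_def ident[OF that, symmetric] by (subst integral_distr) (auto intro: meas that)
  have s_nonneg: "0 \<le> s"
    unfolding s_def by simp
  have parts: "(\<Sum>k=1..n. r_coeff n k l * incr (v n) k \<omega>) = (\<Sum>k\<in>{0..n}. d n l k * v n k \<omega>)" for n l \<omega>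
    unfolding incr_def d_def atLeast0AtMost
    by (rule sum_by_parts_zero_ends) simp_all
  have d_sum: "(\<Sum>k\<in>{0..n}. d n l k) = 0" for n l
    unfolding d_def atLeast0AtMost by (subst sum_telescope) simp
  have inner_int: "integrable M (\<lambda>\<omega>. (\<Sum>k=1..n. r_coeff n k l * incr (v n) k \<omega>)\<^sup>2)"
    and inner_le: "expectation (\<lambda>\<omega>. (\<Sum>k=1..n. r_coeff n k l * incr (v n) k \<omega>)\<^sup>2)
                   \<le> s * (2 * (real l * pi / real (n + 1))\<^sup>2)"
    if n: "n \<ge> 1" for n l
  proof -
    note iid = expectation_square_weighted_iid_sum[OF _ indep[OF n], of \<mu> s "d n l"]
    show "integrable M (\<lambda>\<omega>. (\<Sum>k=1..n. r_coeff n k l * incr (v n) k \<omega>)\<^sup>2)"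
      unfolding parts using n by (intro iid(1)) (auto intro: sq_int mean second)
    have "expectation (\<lambda>\<omega>. (\<Sum>k=1..n. r_coeff n k l * incr (v n) k \<omega>)\<^sup>2) =
          (s - \<mu>\<^sup>2) * (\<Sum>k\<in>{0..n}. (d n l k)\<^sup>2)"
      unfolding parts using n by (subst iid(2)) (auto intro: sq_int mean second simp: d_sum)
    also have "\<dots> \<le> s * (2 * (real l * pi / real (n + 1))\<^sup>2)"
      using sum_r_coeff_diff_squares_le[of n l] s_nonneg
      unfolding d_def atLeast0AtMost by (intro mult_mono) (auto intro: sum_nonneg)
    finally show "expectation (\<lambda>\<omega>. (\<Sum>k=1..n. r_coeff n k l * incr (v n) k \<omega>)\<^sup>2)
                   \<le> s * (2 * (real l * pi / real (n + 1))\<^sup>2)" .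
  qed
  let ?E = "\<lambda>n. \<integral>\<omega>. real (n + 1) / real (m n) *
            (\<Sum>l=1..m n. (\<Sum>k=1..n. r_coeff n k l * incr (v n) k \<omega>)\<^sup>2) \<partial>M"
  have upper: "?E n \<le> 2 * s * pi\<^sup>2 * (real (m n) / real n powr (1/2))\<^sup>2" if n: "n \<ge> 1" for n
  proof -
    have m_pos: "real (m n) > 0" using m_bounds[OF n] by simp
    have "?E n = real (n + 1) / real (m n) *
            (\<Sum>l=1..m n. expectation (\<lambda>\<omega>. (\<Sum>k=1..n. r_coeff n k l * incr (v n) k \<omega>)\<^sup>2))"
      using inner_int[OF n] by (simp add: Bochner_Integration.integral_sum)
    also have "\<dots> \<le> real (n + 1) / real (m n) *
            (real (card {1..m n}) * (s * (2 * (real (m n) * pi / real (n + 1))\<^sup>2)))"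
    proof (intro mult_left_mono sum_bounded_above)
      fix l assume "l \<in> {1..m n}"
      then have "s * (2 * (real l * pi / real (n + 1))\<^sup>2) \<le> s * (2 * (real (m n) * pi / real (n + 1))\<^sup>2)"
        using s_nonneg by (intro mult_left_mono power_mono divide_right_mono mult_right_mono) auto
      with inner_le[OF n, of l]
      show "expectation (\<lambda>\<omega>. (\<Sum>k=1..n. r_coeff n k l * incr (v n) k \<omega>)\<^sup>2)
            \<le> s * (2 * (real (m n) * pi / real (n + 1))\<^sup>2)" by linarith
    qed simp
    also have "\<dots> = 2 * s * pi\<^sup>2 * ((real (m n))\<^sup>2 / real (n + 1))"
    proof -
      have "b / a * (a * (s * (2 * (a * pi / b)\<^sup>2))) = 2 * s * pi\<^sup>2 * (a\<^sup>2 / b)"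
        if "a > 0" "b > 0" for a b :: real
        using that by (simp add: field_simps power2_eq_square)
      from this[OF m_pos, of "real (n + 1)"] show ?thesis by simp
    qed
    also have "\<dots> \<le> 2 * s * pi\<^sup>2 * ((real (m n))\<^sup>2 / real n)"
      using s_nonneg n by (intro mult_left_mono divide_left_mono) auto
    also have "(real (m n))\<^sup>2 / real n = (real (m n) / real n powr (1/2))\<^sup>2"
      by (simp add: power_divide powr_half_sqrt)
    finally show ?thesis .
  qed
  have "(\<lambda>n. real (m n) / real n powr (1/2)) \<longlonglongrightarrow> 0"
    by (rule smalloD_tendsto[OF m_small])
  then have "(\<lambda>n. 2 * s * pi\<^sup>2 * (real (m n) / real n powr (1/2))\<^sup>2) \<longlonglongrightarrow> 2 * s * pi\<^sup>2 * 0\<^sup>2"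
    by (intro tendsto_intros)
  then have bound_lim: "(\<lambda>n. 2 * s * pi\<^sup>2 * (real (m n) / real n powr (1/2))\<^sup>2) \<longlonglongrightarrow> 0"
    by simp
  show ?thesis
  proof (rule tendsto_sandwich[OF _ _ tendsto_const bound_lim])
    show "\<forall>\<^sub>F n in sequentially. 0 \<le> ?E n"
      by (intro always_eventually allI integral_nonneg_AE AE_I2 mult_nonneg_nonneg sum_nonneg) auto
    show "\<forall>\<^sub>F n in sequentially. ?E n \<le> 2 * s * pi\<^sup>2 * (real (m n) / real n powr (1/2))\<^sup>2"
      using eventually_ge_at_top[of 1] by eventually_elim (rule upper)
  qed
qed

end
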